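(* Let $(G,\mu,\alpha)$ be a Hom-algebra over $\mathbb{K}$ such that $\alpha$ is an automorphism of $G$, let $(M,\psi,\gamma)$ and $(N,\psi',\gamma')$ be two right Hom-modules over $(G,\mu,\alpha)$, and let $(M^{\circ},\psi^{\circ},\gamma^{\circ})$ and $(N^{\circ},\psi'^{\circ},\gamma'^{\circ})$ be the corresponding right Hom-comodules over $G^{\circ}$ under the Sweedler duality. Let $\sigma:M\to N$ be a morphism of right Hom-modules, and let $\sigma^{\circ}:=\sigma^{*}|_{N^{\circ}}:N^{\circ}\to M^{*}$. Then $\sigma^{\circ}$ is a morphism of right Hom-comodules over $G^{\circ}$ (from $N^{\circ}$ to $M^{\circ}$).
   Context: $\mathbb{K}$ is a field of characteristic zero; all linear spaces and tensor products are over $\mathbb{K}$, and $V^*$ is the full linear dual of $V$. A Hom-algebra (Hom-associative algebra) is a triple $(G,\mu,\alpha)$ where $G$ is a linear space, $\mu:G\otimes G\to G$, $\mu(g\otimes g')=gg'$, is a linear map and $\alpha:G\to G$ is a linear map such that $\alpha(g)(hk)=(gh)\alpha(k)$ and $\alpha(hk)=\alpha(h)\alpha(k)$ for all $g,h,k\in G$. No unit is required. That $\alpha$ is an automorphism means that it is moreover bijective. An ideal of $G$ is a subspace $H\subseteq G$ such that $\alpha(H)\subseteq H$ and $ab\in H$, $ba\in H$ for all $a\in G$, $b\in H$. It is finite-codimensional if $\dim(G/H)<\infty$. A right Hom-module of $(G,\mu,\alpha)$ is a triple $(M,\psi,\gamma)$ where $M$ is a linear space and $\psi:M\otimes G\to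 M$, $\psi(m\otimes g)=m\cdot g$, and $\gamma:M\to M$ are linear maps with $\psi\circ(\psi\otimes\alpha)=\psi\circ(\gamma\otimes\mu)$ and $\psi\circ(\gamma\otimes\alpha)=\gamma\circ\psi$. A morphism of right Hom-modules $\sigma:(M,\psi,\gamma)\to(N,\psi',\gamma')$ is a linear map with $\sigma\circ\psi=\psi'\circ(\sigma\otimes\alpha)$ and $\gamma'\circ\sigma=\sigma\circ\gamma$ (note the $\alpha$ in the first condition). A Hom-coalgebra is a triple $(C,\Delta,\beta)$ where $C$ is a linear space and $\Delta:C\to C\otimes C$, $\beta:C\to C$ are linear maps with $(\beta\otimes\Delta)\circ\Delta=(\Delta\otimes\beta)\circ\Delta$ and $\Delta\circ\beta=(\beta\otimes\beta)\circ\Delta$. No counit is required. A right Hom-comodule of $(C,\Delta,\beta)$ is a triple $(A,\phi,\epsilon)$ where $A$ is a linear space and $\phi:A\to A\otimes C$, $\epsilon:A\to A$ are linear maps with $(\phi\otimes\beta)\circ\phi=(\epsilon\otimes\Delta)\circ\phi$ and $(\epsilon\otimes\beta)\circ\phi=\phi\circ\epsilon$. A morphism of right Hom-comodules $f:(A,\phi,\epsilon)\to(A',\phi',\epsilon')$ of $C$ is a linear map with $\phi'\circ f=(f\otimes\beta)\circ\phi$ and $\epsilon'\circ f=f\circ\epsilon$. Sweedler dualities: $G^{\circ}=\{f\in G^*\mid \operatorname{Ker} f\supseteq J \text{ for some finite-codimensional ideal } J \text{ of } G\}$, and $M^{\circ}=\{f\in M^*\mid f(M\cdot I)=0 \text{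 for some finite-codimensional ideal } I \text{ of } G\}$, where $M\cdot I$ is the span of all $m\cdot a$ with $m\in M$, $a\in I$; similarly for $N^{\circ}$. $G^{\circ}$ is the Hom-coalgebra $(G^{\circ},\Delta,\alpha^{\circ})$ with $\Delta=\mu^*|_{G^{\circ}}$, $\alpha^{\circ}=\alpha^*|_{G^{\circ}}$, where $\langle\mu^*(f),x\otimes y\rangle=\langle f,\mu(x\otimes y)\rangle$ and $\alpha^*(f)=f\circ\alpha$. The right Hom-comodule structure on $M^{\circ}$ over $G^{\circ}$ is $\psi^{\circ}=\psi^*|_{M^{\circ}}:M^{\circ}\to M^{\circ}\otimes G^{\circ}$, $\gamma^{\circ}=\gamma^*|_{M^{\circ}}:M^{\circ}\to M^{\circ}$, where $\langle\psi^*(\xi),m\otimes g\rangle=\langle\xi,\psi(m\otimes g)\rangle$ and $\gamma^*(\xi)=\xi\circ\gamma$; similarly for $N^{\circ}$ with $\psi',\gamma'$. The spaces $G^{\circ}\otimes G^{\circ}$ and $M^{\circ}\otimes G^{\circ}$ are regarded as subspaces of $(G\otimes G)^*$ and $(M\otimes G)^*$ via $(f\otimes g)(x\otimes y)=f(x)g(y)$. The map $\sigma^*:N^*\to M^*$ is $\sigma^*(\xi)=\xi\circ\sigma$. The assertion includes that $\sigma^{\circ}(N^{\circ})\subseteq M^{\circ}$. *)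

theory Defs
  imports Complex_Main "HOL-Library.Function_Algebras"
begin

section \<open>Hom-algebras and right Hom-modules\<close>

text \<open>
  A linear map out of a tensor product of two linear spaces is given by the corresponding
  (curried) bilinear map.
\<close>

definition bilinear_map ::
  "('k::field \<Rightarrow> 'u::ab_group_add \<Rightarrow> 'u) \<Rightarrow> ('k \<Rightarrow> 'v::ab_group_add \<Rightarrow> 'v) \<Rightarrow>
   ('k \<Rightarrow> 'w::ab_group_add \<Rightarrow> 'w) \<Rightarrow> ('u \<Rightarrow> 'v \<Rightarrow> 'w) \<Rightarrow> bool" where
  "bilinear_map sU sV sW B \<longleftrightarrow>
     (\<forall>u. Vector_Spaces.linear sV sW (B u)) \<and> (\<forall>v. Vector_Spaces.linear sU sW (\<lambda>u. B u v))"

locale hom_algebra = vector_space sG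
  for sG :: "'k::field \<Rightarrow> 'g::ab_group_add \<Rightarrow> 'g" +
  fixes mult :: "'g \<Rightarrow> 'g \<Rightarrow> 'g" and \<alpha> :: "'g \<Rightarrow> 'g"
  assumes bilinear_mult: "bilinear_map sG sG sG mult"
    and linear_twist: "Vector_Spaces.linear sG sG \<alpha>"
    and hom_assoc: "mult (\<alpha> g) (mult h k) = mult (mult g h) (\<alpha> k)"
    and twist_mult: "\<alpha> (mult h k) = mult (\<alpha> h) (\<alpha> k)"

locale right_hom_module = hom_algebra sG mult \<alpha> + M: vector_space sM
  for sG :: "'k::field \<Rightarrow> 'g::ab_group_add \<Rightarrow> 'g" and mult \<alpha>
    and sM :: "'k \<Rightarrow> 'm::ab_group_add \<Rightarrow> 'm" +
  fixes \<psi> :: "'m \<Rightarrow> 'g \<Rightarrow> 'm" and \<gamma> :: "'m \<Rightarrow> 'm"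
  assumes bilinear_act: "bilinear_map sM sG sM \<psi>"
    and linear_mod_twist: "Vector_Spaces.linear sM sM \<gamma>"
    and act_assoc: "\<psi> (\<psi> m g) (\<alpha> h) = \<psi> (\<gamma> m) (mult g h)"
    and twist_act: "\<psi> (\<gamma> m) (\<alpha> g) = \<gamma> (\<psi> m g)"

locale right_hom_module_morphism =
    M: right_hom_module sG mult \<alpha> sM \<psi> \<gamma> + N: right_hom_module sG mult \<alpha> sN \<psi>' \<gamma>'
  for sG :: "'k::field \<Rightarrow> 'g::ab_group_add \<Rightarrow> 'g" and mult \<alpha>
    and sM :: "'k \<Rightarrow> 'm::ab_group_add \<Rightarrow> 'm" and \<psi> \<gamma>
    and sN :: "'k \<Rightarrow> 'n::ab_group_add \<Rightarrow> 'n" and \<psi>' \<gamma>' +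
  fixes \<sigma> :: "'m \<Rightarrow> 'n"
  assumes linear_morphism: "Vector_Spaces.linear sM sN \<sigma>"
    and morphism_act: "\<sigma> (\<psi> m g) = \<psi>' (\<sigma> m) (\<alpha> g)"
    and morphism_twist: "\<gamma>' (\<sigma> m) = \<sigma> (\<gamma> m)"


section \<open>Linear spaces of functions and their tensor products\<close>

text \<open>
  The coalgebras and comodules below live on subspaces of spaces of all functions
  \<open>'x \<Rightarrow> 'k\<close>.  The tensor product of \<open>C \<subseteq> ('x \<Rightarrow> 'k)\<close> and \<open>D \<subseteq> ('y \<Rightarrow> 'k)\<close> is realised inside
  \<open>'x \<times> 'y \<Rightarrow> 'k\<close> by \<open>(f \<otimes> g)(x, y) = f x g y\<close>; for spaces of linear forms this is the usual
  identification of a tensor product of spaces of linear forms with a space of bilinear forms.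
  That this is indeed a tensor product is lemma \<open>tensor_space_universal\<close>: every bilinear map \<open>B\<close>
  on \<open>C \<times> D\<close> induces a well-defined map \<open>\<Sum> f\<^sub>i \<otimes> g\<^sub>i \<mapsto> \<Sum> B f\<^sub>i g\<^sub>i\<close>.
\<close>

definition fun_scale :: "'k::field \<Rightarrow> ('x \<Rightarrow> 'k) \<Rightarrow> 'x \<Rightarrow> 'k" where
  "fun_scale c f = (\<lambda>x. c * f x)"

global_interpretation fun_space: vector_space "fun_scale :: 'k::field \<Rightarrow> ('x \<Rightarrow> 'k) \<Rightarrow> 'x \<Rightarrow> 'k"
  by unfold_locales (auto simp: fun_scale_def fun_eq_iff algebra_simps)

definition linear_between ::
  "('x \<Rightarrow> 'k::field) set \<Rightarrow> ('y \<Rightarrow> 'k) set \<Rightarrow> (('x \<Rightarrow> 'k) \<Rightarrow> ('y \<Rightarrow> 'k)) \<Rightarrow> bool" where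
  "linear_between C D F \<longleftrightarrow>
     (\<forall>f\<in>C. F f \<in> D) \<and> (\<forall>f\<in>C. \<forall>g\<in>C. F (f + g) = F f + F g) \<and>
     (\<forall>c. \<forall>f\<in>C. F (fun_scale c f) = fun_scale c (F f))"

definition tensor :: "('x \<Rightarrow> 'k::field) \<Rightarrow> ('y \<Rightarrow> 'k) \<Rightarrow> 'x \<times> 'y \<Rightarrow> 'k" where
  "tensor f g = (\<lambda>(x, y). f x * g y)"

definition tensor_space ::
  "('x \<Rightarrow> 'k::field) set \<Rightarrow> ('y \<Rightarrow> 'k) set \<Rightarrow> ('x \<times> 'y \<Rightarrow> 'k) set" where
  "tensor_space C D = fun_space.span {tensor f g | f g. f \<in> C \<and> g \<in> D}"

text \<open>
  \<open>tensor_map C D F H\<close> is the map \<open>F \<otimes> H\<close> on \<open>tensor_space C D\<close>, where \<open>F\<close> and \<open>H\<close> are linear on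
  \<open>C\<close> and \<open>D\<close>; independence of the chosen representation is lemma \<open>tensor_map_sum\<close>.
\<close>

definition tensor_map ::
  "('x \<Rightarrow> 'k::field) set \<Rightarrow> ('y \<Rightarrow> 'k) set \<Rightarrow> (('x \<Rightarrow> 'k) \<Rightarrow> ('x' \<Rightarrow> 'k)) \<Rightarrow>
   (('y \<Rightarrow> 'k) \<Rightarrow> ('y' \<Rightarrow> 'k)) \<Rightarrow> ('x \<times> 'y \<Rightarrow> 'k) \<Rightarrow> ('x' \<times> 'y' \<Rightarrow> 'k)" where
  "tensor_map C D F H t = (THE u. \<exists>(n::nat) f g. (\<forall>i<n. f i \<in> C \<and> g i \<in> D) \<and>
     t = (\<Sum>i<n. tensor (f i) (g i)) \<and> u = (\<Sum>i<n. tensor (F (f i)) (H (g i))))"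

text \<open>The canonical isomorphism \<open>(C \<otimes> D) \<otimes> E \<rightarrow> C \<otimes> (D \<otimes> E)\<close>.\<close>

definition tensor_assoc :: "(('x \<times> 'y) \<times> 'z \<Rightarrow> 'k) \<Rightarrow> 'x \<times> 'y \<times> 'z \<Rightarrow> 'k" where
  "tensor_assoc t = (\<lambda>(x, y, z). t ((x, y), z))"

lemma sum_fun_apply: "(\<Sum>i\<in>A. f i) x = (\<Sum>i\<in>A. f i x)"
  for f :: "'i \<Rightarrow> 'x \<Rightarrow> 'k::comm_monoid_add"
  by (induction A rule: infinite_finite_induct) auto

lemma tensor_bilinear:
  "tensor (f + f') g = tensor f g + tensor f' g" "tensor f (g + g') = tensor f g + tensor f g'"
  "tensor (fun_scale c f) g = fun_scale c (tensor f g)"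
  "tensor f (fun_scale c g) = fun_scale c (tensor f g)"
  by (auto simp: tensor_def fun_scale_def fun_eq_iff algebra_simps)

lemma tensor_space_elem:
  assumes "fun_space.subspace C" and "t \<in> tensor_space C D"
  obtains n :: nat and f g where "\<And>i. i < n \<Longrightarrow> f i \<in> C \<and> g i \<in> D"
    and "t = (\<Sum>i<n. tensor (f i) (g i))"
proof -
  have "\<exists>(n::nat) f g. (\<forall>i<n. f i \<in> C \<and> g i \<in> D) \<and> t = (\<Sum>i<n. tensor (f i) (g i))"
    using assms(2) unfolding tensor_space_def
  proof (induction rule: fun_space.span_induct_alt)
    case base
    show ?case by (rule exI[of _ 0]) auto
  next
    case (step c x y)
    then obtain a b n f g where ab: "x = tensor a b" "a \<in> C" "b \<in> D"
      and fg: "\<forall>i<n. f i \<in> C \<and> g i \<in> D" "y = (\<Sum>i<(n::nat). tensor (f i) (g i))"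
      by auto
    have "fun_scale c a \<in> C" using assms(1) ab by (simp add: fun_space.subspace_def)
    moreover have "fun_scale c x = tensor (fun_scale c a) b"
      by (auto simp: ab tensor_def fun_scale_def mult.assoc)
    ultimately show ?case using ab fg
      by (intro exI[of _ "Suc n"] exI[of _ "f(n := fun_scale c a)"] exI[of _ "g(n := b)"])
        (auto simp: less_Suc_eq add.commute)
  qed
  then show thesis using that by blast
qed

lemma bilinear_vanish:
  fixes sW :: "'k::field \<Rightarrow> 'w::ab_group_add \<Rightarrow> 'w"
    and B :: "('x \<Rightarrow> 'k) \<Rightarrow> ('y \<Rightarrow> 'k) \<Rightarrow> 'w"
  assumes "vector_space sW" and C: "fun_space.subspace C" and D: "fun_space.subspace D"
    and add_left: "\<And>f f' g. f \<in> C \<Longrightarrow> f' \<in> C \<Longrightarrow> g \<in> D \<Longrightarrow> B (f + f') g = B f g + B f' g"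
    and scale_left: "\<And>c f g. f \<in> C \<Longrightarrow> g \<in> D \<Longrightarrow> B (fun_scale c f) g = sW c (B f g)"
    and add_right: "\<And>f g g'. f \<in> C \<Longrightarrow> g \<in> D \<Longrightarrow> g' \<in> D \<Longrightarrow> B f (g + g') = B f g + B f g'"
    and scale_right: "\<And>c f g. f \<in> C \<Longrightarrow> g \<in> D \<Longrightarrow> B f (fun_scale c g) = sW c (B f g)"
    and "\<And>i. i < n \<Longrightarrow> f i \<in> C \<and> g i \<in> D"
    and "(\<Sum>i<(n::nat). tensor (f i) (g i)) = 0"
  shows "(\<Sum>i<n. B (f i) (g i)) = 0"
  using assms(8,9)
proof (induction n arbitrary: f g)
  case 0
  show ?case by simp
next
  case (Suc n)
  interpret W: vector_space sW by fact
  have in_CD: "f i \<in> C" "g i \<in> D" if "i \<le> n" for i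
    using Suc.prems(1)[of i] that by auto
  have zero: "(\<Sum>i<n. f i x * g i y) + f n x * g n y = 0" for x y
    using fun_cong[OF Suc.prems(2), of "(x, y)"] by (simp add: sum_fun_apply tensor_def)
  show ?case
  proof (cases "f n = 0")
    case True
    then have "(\<Sum>i<n. tensor (f i) (g i)) = 0"
      using zero by (auto simp: fun_eq_iff sum_fun_apply tensor_def)
    then have "(\<Sum>i<n. B (f i) (g i)) = 0" using Suc.IH in_CD by simp
    moreover have "B (f n) (g n) = 0"
      using scale_left[of "f n" "g n" 0] in_CD[of n] True by simp
    ultimately show ?thesis by simp
  next
    case False
    then obtain x0 where x0: "f n x0 \<noteq> 0" by (auto simp: fun_eq_iff)
    define c where "c i = - f i x0 / f n x0" for i
    have gn: "g n = (\<Sum>i<n. fun_scale (c i) (g i))"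
    proof
      fix y
      have "f n x0 * g n y = - (\<Sum>i<n. f i x0 * g i y)"
        using zero[of x0 y] by (simp add: add_eq_0_iff2)
      then have "g n y = - (\<Sum>i<n. f i x0 * g i y) / f n x0"
        using x0 by (simp add: field_simps)
      also have "\<dots> = (\<Sum>i<n. c i * g i y)"
        by (simp add: c_def sum_divide_distrib sum_negf[symmetric])
      finally show "g n y = (\<Sum>i<n. fun_scale (c i) (g i)) y"
        by (simp add: sum_fun_apply fun_scale_def)
    qed
    have B_sum: "B (f n) (\<Sum>i<m. fun_scale (c i) (g i)) = (\<Sum>i<m. sW (c i) (B (f n) (g i)))"
      if "m \<le> n" for m
      using that
    proof (induction m)
      case 0
      show ?case using scale_right[of "f n" "g n" 0] in_CD by (simp add: zero_fun_def)
    next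
      case (Suc m)
      have "(\<Sum>i<m. fun_scale (c i) (g i)) \<in> D"
        using Suc.prems in_CD D by (intro fun_space.subspace_sum fun_space.subspace_scale) auto
      then have "B (f n) ((\<Sum>i<m. fun_scale (c i) (g i)) + fun_scale (c m) (g m)) =
          B (f n) (\<Sum>i<m. fun_scale (c i) (g i)) + B (f n) (fun_scale (c m) (g m))"
        using Suc.prems in_CD D by (intro add_right) (auto intro: fun_space.subspace_scale)
      moreover have "B (f n) (fun_scale (c m) (g m)) = sW (c m) (B (f n) (g m))"
        using Suc.prems in_CD by (intro scale_right) auto
      ultimately show ?case
        using Suc by (simp only: sum.lessThan_Suc Suc_leD)
    qed
    have "(\<Sum>i<n. tensor (f i + fun_scale (c i) (f n)) (g i)) = 0"
    proof
      fix p :: "'x \<times> 'y"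
      obtain x y where p: "p = (x, y)" by fastforce
      have "(\<Sum>i<n. (f i x + c i * f n x) * g i y) = (\<Sum>i<n. f i x * g i y) + f n x * g n y"
        by (simp add: gn sum_fun_apply fun_scale_def algebra_simps sum.distrib sum_distrib_left)
      then show "(\<Sum>i<n. tensor (f i + fun_scale (c i) (f n)) (g i)) p = 0 p"
        using zero[of x y] by (simp add: p sum_fun_apply tensor_def fun_scale_def)
    qed
    moreover have "f i + fun_scale (c i) (f n) \<in> C" if "i < n" for i
      using that by (intro fun_space.subspace_add[OF C] fun_space.subspace_scale[OF C] in_CD) auto
    moreover have "g i \<in> D" if "i < n" for i using that in_CD by simp
    ultimately have "(\<Sum>i<n. B (f i + fun_scale (c i) (f n)) (g i)) = 0"
      by (intro Suc.IH[where f = "\<lambda>i. f i + fun_scale (c i) (f n)" and g = g] conjI)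
    then have "(\<Sum>i<n. B (f i) (g i)) + (\<Sum>i<n. sW (c i) (B (f n) (g i))) = 0"
      using in_CD C
      by (simp add: add_left scale_left fun_space.subspace_scale sum.distrib)
    then show ?thesis using B_sum[of n] gn by simp
  qed
qed

lemma tensor_space_universal:
  fixes sW :: "'k::field \<Rightarrow> 'w::ab_group_add \<Rightarrow> 'w"
    and B :: "('x \<Rightarrow> 'k) \<Rightarrow> ('y \<Rightarrow> 'k) \<Rightarrow> 'w"
  assumes "vector_space sW" "fun_space.subspace C" "fun_space.subspace D"
    and "\<And>f f' g. f \<in> C \<Longrightarrow> f' \<in> C \<Longrightarrow> g \<in> D \<Longrightarrow> B (f + f') g = B f g + B f' g"
    and "\<And>c f g. f \<in> C \<Longrightarrow> g \<in> D \<Longrightarrow> B (fun_scale c f) g = sW c (B f g)"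
    and "\<And>f g g'. f \<in> C \<Longrightarrow> g \<in> D \<Longrightarrow> g' \<in> D \<Longrightarrow> B f (g + g') = B f g + B f g'"
    and "\<And>c f g. f \<in> C \<Longrightarrow> g \<in> D \<Longrightarrow> B f (fun_scale c g) = sW c (B f g)"
    and "\<And>i. i < n \<Longrightarrow> f i \<in> C \<and> g i \<in> D" "\<And>i. i < m \<Longrightarrow> f' i \<in> C \<and> g' i \<in> D"
    and eq: "(\<Sum>i<(n::nat). tensor (f i) (g i)) = (\<Sum>i<(m::nat). tensor (f' i) (g' i))"
  shows "(\<Sum>i<n. B (f i) (g i)) = (\<Sum>i<m. B (f' i) (g' i))"
proof -
  interpret W: vector_space sW by fact
  have split: "(\<Sum>i<n + m. h i) = (\<Sum>i<n. h i) + (\<Sum>i<m. h (n + i))"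
    for h :: "nat \<Rightarrow> 'z::ab_group_add"
    by (induction m) (auto simp: add.assoc)
  define F where "F i = (if i < n then f i else - f' (i - n))" for i
  define H where "H i = (if i < n then g i else g' (i - n))" for i
  have FH: "F i \<in> C \<and> H i \<in> D" if "i < n + m" for i
    using that assms(2,8,9) by (auto simp: F_def H_def intro: fun_space.subspace_neg)
  have neg: "tensor (- a) b = - tensor a b" for a :: "'x \<Rightarrow> 'k" and b :: "'y \<Rightarrow> 'k"
    by (auto simp: tensor_def fun_eq_iff)
  have "(\<Sum>i<n + m. tensor (F i) (H i)) = 0"
    unfolding split by (simp add: F_def H_def neg sum_negf eq)
  then have "(\<Sum>i<n + m. B (F i) (H i)) = 0"
    by (intro bilinear_vanish[where f = F and g = H and B = B, OF assms(1-3)] assms(4-7) FH)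
  moreover have "B (- a) b = - B a b" if "a \<in> C" "b \<in> D" for a b
    using assms(5)[of a b "-1"] that by simp
  ultimately show ?thesis
    unfolding split using assms(9) by (simp add: F_def H_def sum_negf)
qed

lemma tensor_map_sum:
  assumes "fun_space.subspace C" "fun_space.subspace D"
    and F: "linear_between C C' F" and H: "linear_between D D' H"
    and "\<And>i. i < n \<Longrightarrow> f i \<in> C \<and> g i \<in> D"
  shows "tensor_map C D F H (\<Sum>i<(n::nat). tensor (f i) (g i)) =
    (\<Sum>i<n. tensor (F (f i)) (H (g i)))"
proof -
  have bilin:
    "tensor (F (a + a')) (H b) = tensor (F a) (H b) + tensor (F a') (H b)"
    "tensor (F (fun_scale c a)) (H b) = fun_scale c (tensor (F a) (H b))"
    "tensor (F a) (H (b + b')) = tensor (F a) (H b) + tensor (F a) (H b')"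
    "tensor (F a) (H (fun_scale c b)) = fun_scale c (tensor (F a) (H b))"
    if "a \<in> C" "a' \<in> C" "b \<in> D" "b' \<in> D" for a a' b b' c
    using that F H by (simp_all add: linear_between_def tensor_bilinear)
  show ?thesis
    unfolding tensor_map_def
  proof (rule the_equality)
    show "\<exists>(m::nat) f' g'. (\<forall>i<m. f' i \<in> C \<and> g' i \<in> D) \<and>
        (\<Sum>i<n. tensor (f i) (g i)) = (\<Sum>i<m. tensor (f' i) (g' i)) \<and>
        (\<Sum>i<n. tensor (F (f i)) (H (g i))) = (\<Sum>i<m. tensor (F (f' i)) (H (g' i)))"
      using assms(5) by blast
  next
    fix u
    assume "\<exists>(m::nat) f' g'. (\<forall>i<m. f' i \<in> C \<and> g' i \<in> D) \<and>
        (\<Sum>i<n. tensor (f i) (g i)) = (\<Sum>i<m. tensor (f' i) (g' i)) \<and>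
        u = (\<Sum>i<m. tensor (F (f' i)) (H (g' i)))"
    then obtain m :: nat and f' g' where m: "\<And>i. i < m \<Longrightarrow> f' i \<in> C \<and> g' i \<in> D"
      and eq: "(\<Sum>i<n. tensor (f i) (g i)) = (\<Sum>i<m. tensor (f' i) (g' i))"
      and u: "u = (\<Sum>i<m. tensor (F (f' i)) (H (g' i)))" by blast
    show "u = (\<Sum>i<n. tensor (F (f i)) (H (g i)))"
      unfolding u
      using tensor_space_universal[where sW = fun_scale and C = C and D = D
          and B = "\<lambda>a b. tensor (F a) (H b)" and f = f and g = g and f' = f' and g' = g',
          OF fun_space.vector_space_axioms assms(1,2) bilin assms(5) m eq]
      by simp
  qed
qed


section \<open>Hom-coalgebras and right Hom-comodules\<close>

text \<open>The structure maps are only constrained on the carriers.\<close>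

locale hom_coalgebra =
  fixes C :: "('x \<Rightarrow> 'k::field) set"
    and \<Delta> :: "('x \<Rightarrow> 'k) \<Rightarrow> ('x \<times> 'x \<Rightarrow> 'k)" and \<beta> :: "('x \<Rightarrow> 'k) \<Rightarrow> ('x \<Rightarrow> 'k)"
  assumes subspace_coalgebra: "fun_space.subspace C"
    and linear_comult: "linear_between C (tensor_space C C) \<Delta>"
    and linear_cotwist: "linear_between C C \<beta>"
    and hom_coassoc: "c \<in> C \<Longrightarrow>
          tensor_map C C \<beta> \<Delta> (\<Delta> c) = tensor_assoc (tensor_map C C \<Delta> \<beta> (\<Delta> c))"
    and comult_cotwist: "c \<in> C \<Longrightarrow> \<Delta> (\<beta> c) = tensor_map C C \<beta> \<beta> (\<Delta> c)"

locale right_hom_comodule = hom_coalgebra C \<Delta> \<beta>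
  for C :: "('x \<Rightarrow> 'k::field) set" and \<Delta> \<beta> +
  fixes A :: "('y \<Rightarrow> 'k) set"
    and \<phi> :: "('y \<Rightarrow> 'k) \<Rightarrow> ('y \<times> 'x \<Rightarrow> 'k)" and \<epsilon> :: "('y \<Rightarrow> 'k) \<Rightarrow> ('y \<Rightarrow> 'k)"
  assumes subspace_comodule: "fun_space.subspace A"
    and linear_coact: "linear_between A (tensor_space A C) \<phi>"
    and linear_mod_cotwist: "linear_between A A \<epsilon>"
    and coact_coassoc: "a \<in> A \<Longrightarrow>
          tensor_assoc (tensor_map A C \<phi> \<beta> (\<phi> a)) = tensor_map A C \<epsilon> \<Delta> (\<phi> a)"
    and coact_cotwist: "a \<in> A \<Longrightarrow> tensor_map A C \<epsilon> \<beta> (\<phi> a) = \<phi> (\<epsilon> a)"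

locale right_hom_comodule_morphism =
    A: right_hom_comodule C \<Delta> \<beta> A \<phi> \<epsilon> + A': right_hom_comodule C \<Delta> \<beta> A' \<phi>' \<epsilon>'
  for C :: "('x \<Rightarrow> 'k::field) set" and \<Delta> \<beta>
    and A :: "('y \<Rightarrow> 'k) set" and \<phi> \<epsilon> and A' :: "('z \<Rightarrow> 'k) set" and \<phi>' \<epsilon>' +
  fixes f :: "('y \<Rightarrow> 'k) \<Rightarrow> ('z \<Rightarrow> 'k)"
  assumes linear_comorphism: "linear_between A A' f"
    and comorphism_coact: "a \<in> A \<Longrightarrow> \<phi>' (f a) = tensor_map A C f \<beta> (\<phi> a)"
    and comorphism_cotwist: "a \<in> A \<Longrightarrow> \<epsilon>' (f a) = f (\<epsilon> a)"


section \<open>Sweedler duality\<close>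

definition is_ideal ::
  "('k::field \<Rightarrow> 'g::ab_group_add \<Rightarrow> 'g) \<Rightarrow> ('g \<Rightarrow> 'g \<Rightarrow> 'g) \<Rightarrow> ('g \<Rightarrow> 'g) \<Rightarrow> 'g set \<Rightarrow> bool" where
  "is_ideal sG mult \<alpha> H \<longleftrightarrow> module.subspace sG H \<and> \<alpha> ` H \<subseteq> H \<and>
     (\<forall>a. \<forall>b\<in>H. mult a b \<in> H \<and> mult b a \<in> H)"

text \<open>
  The quotient space \<open>V/H\<close> is finite-dimensional, that is, spanned by the cosets of a finite
  set \<open>S\<close>: every coset of \<open>H\<close> is the coset of a linear combination of elements of \<open>S\<close>.
\<close>

definition coset :: "'v::ab_group_add set \<Rightarrow> 'v \<Rightarrow> 'v set" where
  "coset H x = {x + h | h. h \<in> H}"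

definition finite_codim :: "('k::field \<Rightarrow> 'v::ab_group_add \<Rightarrow> 'v) \<Rightarrow> 'v set \<Rightarrow> bool" where
  "finite_codim s H \<longleftrightarrow> (\<exists>S. finite S \<and> range (coset H) = coset H ` module.span s S)"

definition linear_dual :: "('k::field \<Rightarrow> 'v::ab_group_add \<Rightarrow> 'v) \<Rightarrow> ('v \<Rightarrow> 'k) set" where
  "linear_dual s = {f. Vector_Spaces.linear s (*) f}"

definition algebra_dual ::
  "('k::field \<Rightarrow> 'g::ab_group_add \<Rightarrow> 'g) \<Rightarrow> ('g \<Rightarrow> 'g \<Rightarrow> 'g) \<Rightarrow> ('g \<Rightarrow> 'g) \<Rightarrow> ('g \<Rightarrow> 'k) set" where
  "algebra_dual sG mult \<alpha> = {f \<in> linear_dual sG.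
     \<exists>J. is_ideal sG mult \<alpha> J \<and> finite_codim sG J \<and> J \<subseteq> {x. f x = 0}}"

definition act_span ::
  "('k::field \<Rightarrow> 'm::ab_group_add \<Rightarrow> 'm) \<Rightarrow> ('m \<Rightarrow> 'g \<Rightarrow> 'm) \<Rightarrow> 'g set \<Rightarrow> 'm set" where
  "act_span sM \<psi> I = module.span sM {\<psi> m a | m a. a \<in> I}"

definition module_dual ::
  "('k::field \<Rightarrow> 'g::ab_group_add \<Rightarrow> 'g) \<Rightarrow> ('g \<Rightarrow> 'g \<Rightarrow> 'g) \<Rightarrow> ('g \<Rightarrow> 'g) \<Rightarrow>
   ('k \<Rightarrow> 'm::ab_group_add \<Rightarrow> 'm) \<Rightarrow> ('m \<Rightarrow> 'g \<Rightarrow> 'm) \<Rightarrow> ('m \<Rightarrow> 'k) set" where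
  "module_dual sG mult \<alpha> sM \<psi> = {\<xi> \<in> linear_dual sM.
     \<exists>I. is_ideal sG mult \<alpha> I \<and> finite_codim sG I \<and> (\<forall>x\<in>act_span sM \<psi> I. \<xi> x = 0)}"

definition pullback :: "('u \<Rightarrow> 'v) \<Rightarrow> ('v \<Rightarrow> 'k) \<Rightarrow> 'u \<Rightarrow> 'k" where
  "pullback F \<xi> = \<xi> \<circ> F"

text \<open>For bilinear \<open>B\<close>, \<open>\<xi>\<close> is pulled back to a bilinear form, i.e. an element of the dual of the
  tensor product.\<close>

definition pullback2 :: "('u \<Rightarrow> 'v \<Rightarrow> 'w) \<Rightarrow> ('w \<Rightarrow> 'k) \<Rightarrow> 'u \<times> 'v \<Rightarrow> 'k" where
  "pullback2 B \<xi> = (\<lambda>(x, y). \<xi> (B x y))"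

end

theory Submission
  imports Defs
begin

text \<open>
  An element of a Sweedler dual kills a finite-codimensional ideal (acting on the right), so its
  pullback along the product or action is a bilinear form of finite rank in the second argument.
  Expanding along dual bases of the quotient by that ideal puts it into the tensor product of the
  duals; that the left factors lie in the dual of the module uses surjectivity of the twist,
  through \<open>(m \<cdot> a) \<cdot> \<alpha>(e) = \<gamma>(m) \<cdot> (a e)\<close>.  All structure maps being pullbacks, the axioms reduce to
  pointwise identities.
\<close>

section \<open>Subspaces of finite codimension\<close>

context vector_space
begin

lemma linear_dual_iff:
  "f \<in> linear_dual scale \<longleftrightarrow> (\<forall>x y. f (x + y) = f x + f y) \<and> (\<forall>c x. f (scale c x) = c * f x)"
  using vector_space_axioms
  by (auto simp: linear_dual_def Vector_Spaces.linear_iff vector_space_def algebra_simps)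

lemma coset_eq_iff:
  assumes "subspace H"
  shows "coset H x = coset H y \<longleftrightarrow> x - y \<in> H"
proof
  assume "coset H x = coset H y"
  moreover have "x \<in> coset H x"
    using subspace_0[OF assms] by (force simp: coset_def)
  ultimately show "x - y \<in> H" by (auto simp: coset_def)
next
  have sub: "coset H x \<subseteq> coset H y" if "x - y \<in> H" for x y
  proof
    fix z assume "z \<in> coset H x"
    then obtain h where h: "h \<in> H" "z = x + h" by (auto simp: coset_def)
    then have "z = y + ((x - y) + h)" by simp
    then show "z \<in> coset H y"
      unfolding coset_def using subspace_add[OF assms that h(1)] by blast
  qed
  assume "x - y \<in> H"
  then show "coset H x = coset H y"
    using sub[of x y] sub[of y x] subspace_neg[OF assms, of "x - y"] by auto
qed

text \<open>Since two cosets of a subspace agree exactly when their representatives differ by an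
  element of it, the coset formulation can be traded for representatives modulo
  \<open>H\<close>.\<close>

lemma finite_codim_iff_span:
  assumes "subspace H"
  shows "finite_codim scale H \<longleftrightarrow> (\<exists>S. finite S \<and> (\<forall>x. \<exists>y\<in>span S. x - y \<in> H))"
proof -
  have "range (coset H) = coset H ` span S \<longleftrightarrow> (\<forall>x. \<exists>y\<in>span S. x - y \<in> H)" for S
  proof -
    have "range (coset H) = coset H ` span S \<longleftrightarrow> (\<forall>x. \<exists>y\<in>span S. coset H x = coset H y)"
      by blast
    then show ?thesis by (simp only: coset_eq_iff[OF assms])
  qed
  then show ?thesis by (simp add: finite_codim_def)
qed

text \<open>A basis of \<open>H\<close> is extended to a basis of the whole space by vectors from a
  finite spanning set modulo \<open>H\<close>. The added vectors represent a basis of the quotient,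
  and their coordinate functionals form its dual basis, lifted to functionals that kill
  \<open>H\<close>.\<close>

lemma finite_codim_dual_basis:
  assumes H: "subspace H" and "finite_codim scale H"
  obtains E \<phi> where "finite E" "\<And>e. \<phi> e \<in> linear_dual scale"
    "\<And>e x. e \<in> E \<Longrightarrow> x \<in> H \<Longrightarrow> \<phi> e x = 0"
    "\<And>x. x - (\<Sum>e\<in>E. scale (\<phi> e x) e) \<in> H"
proof -
  obtain S where S: "finite S" "\<And>x. \<exists>y\<in>span S. x - y \<in> H"
    using assms finite_codim_iff_span by auto
  obtain A where A: "A \<subseteq> H" "independent A" "H \<subseteq> span A"
    using maximal_independent_subset by blast
  \<comment> \<open>\<open>A\<close> is a basis of \<open>H\<close>. The extension draws only on the
    finite set \<open>S\<close>, which makes \<open>B - A\<close> finite.\<close>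
  obtain B where B: "A \<subseteq> B" "B \<subseteq> A \<union> S" "independent B" "A \<union> S \<subseteq> span B"
    using maximal_independent_subset_extend[of A "A \<union> S"] A by blast
  have spanB: "x \<in> span B" for x
  proof -
    obtain y where y: "y \<in> span S" "x - y \<in> H" using S by blast
    have "y \<in> span B" using y B span_minimal[of S "span B"] by auto
    moreover have "x - y \<in> span B" using y A B span_mono[of A B] by auto
    ultimately have "y + (x - y) \<in> span B" by (rule span_add)
    then show ?thesis by simp
  qed
  \<comment> \<open>This is the coordinate of \<open>x\<close> at \<open>e\<close>. For
    \<open>e\<close> outside \<open>B\<close> the value is 0, so linearity holds for every
    \<open>e\<close>.\<close>
  define \<phi> where "\<phi> e x = representation B x e" for e x
  show thesis
  proof
    show "finite (B - A)" using B(2) S(1) by (auto intro: finite_subset[of _ S])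
    show "\<phi> e \<in> linear_dual scale" for e
      by (simp add: linear_dual_iff \<phi>_def representation_add representation_scale B spanB)
    show "\<phi> e x = 0" if "e \<in> B - A" "x \<in> H" for e x
    proof -
      have "x \<in> span A" using that A by auto
      then have "representation B x = representation A x"
        using representation_extend[OF B(3) _ B(1)] by simp
      then show ?thesis
        using that representation_ne_zero[of A x e] by (auto simp: \<phi>_def)
    qed
    show "x - (\<Sum>e\<in>B - A. scale (\<phi> e x) e) \<in> H" for x
    proof -
      \<comment> \<open>The support of \<open>x\<close> in the basis is enlarged by the finite set
        \<open>B - A\<close>, which adds only zero terms. The sum then splits into a part over
        \<open>B - A\<close> and a part over \<open>A\<close>, and the latter lies in
        \<open>H\<close>.\<close>
      let ?T = "{b. representation B x b \<noteq> 0}"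
      have fin: "finite (?T \<union> (B - A))" "finite (B - A)" "finite ?T"
        using \<open>finite (B - A)\<close> finite_representation by auto
      have TB: "?T \<subseteq> B" using representation_ne_zero by auto
      have "x = (\<Sum>b\<in>?T \<union> (B - A). scale (\<phi> b x) b)"
        using sum_nonzero_representation_eq[OF B(3) spanB, of x] fin
        by (subst sum.mono_neutral_right[where S = ?T]) (auto simp: \<phi>_def)
      also have "\<dots> = (\<Sum>b\<in>?T \<inter> A. scale (\<phi> b x) b) + (\<Sum>b\<in>B - A. scale (\<phi> b x) b)"
        using TB fin by (subst sum.union_disjoint[symmetric]) (auto intro!: sum.cong)
      finally have "x - (\<Sum>b\<in>B - A. scale (\<phi> b x) b) = (\<Sum>b\<in>?T \<inter> A. scale (\<phi> b x) b)"
        by (simp add: diff_eq_eq)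
      also have "\<dots> \<in> H"
        using A(1) by (intro subspace_sum subspace_scale H) auto
      finally show ?thesis .
    qed
  qed
qed

text \<open>Evaluating all functionals in \<open>F\<close> maps the space linearly into a
  finite-dimensional one, with kernel inside \<open>H\<close>. Preimages of a basis of the image
  therefore span everything modulo \<open>H\<close>.\<close>

lemma finite_codim_if_functionals:
  assumes H: "subspace H" and F: "finite F" "F \<subseteq> linear_dual scale"
    and ker: "\<And>x. (\<And>f. f \<in> F \<Longrightarrow> f x = 0) \<Longrightarrow> x \<in> H"
  shows "finite_codim scale H"
proof -
  \<comment> \<open>The value 0 outside \<open>F\<close> keeps the range of \<open>L\<close> in the
    span of the finitely many indicator functions \<open>\<delta> f\<close> with \<open>f\<close> in
    \<open>F\<close>.\<close>
  define L where "L x = (\<lambda>f. if f \<in> F then f x else 0)" for x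
  have lin: "f (x + y) = f x + f y" "f (scale c x) = c * f x" if "f \<in> F" for f x y c
    using that F(2) by (auto simp: linear_dual_iff)
  have L: "Vector_Spaces.linear scale fun_scale L"
    unfolding Vector_Spaces.linear_iff
    using vector_space_axioms fun_space.vector_space_axioms
    by (auto simp: L_def fun_eq_iff fun_scale_def lin)
  define \<delta> :: "('b \<Rightarrow> 'a) \<Rightarrow> ('b \<Rightarrow> 'a) \<Rightarrow> 'a" where "\<delta> f = (\<lambda>g. if g = f then 1 else 0)" for f
  have "L x = (\<Sum>f\<in>F. fun_scale (f x) (\<delta> f))" for x
    by (rule ext)
      (simp add: L_def \<delta>_def sum_fun_apply fun_scale_def if_distrib F(1) cong: if_cong)
  then have range_L: "range L \<subseteq> fun_space.span (\<delta> ` F)"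
    by (auto intro!: fun_space.span_sum fun_space.span_scale intro: fun_space.span_base)
  obtain B where B: "B \<subseteq> range L" "fun_space.independent B" "range L \<subseteq> fun_space.span B"
    using fun_space.maximal_independent_subset by blast
  have "finite B"
    using fun_space.independent_span_bound[of "\<delta> ` F" B] F(1) B range_L by auto
  then obtain S where S: "finite S" "B = L ` S"
    using B(1) finite_subset_image[of B L UNIV] by auto
  have "\<exists>y\<in>span S. x - y \<in> H" for x
  proof -
    have "L x \<in> L ` span S"
      using B(3) S(2) module_hom.span_image[OF L[unfolded linear_iff_module_hom], of S] by auto
    then obtain y where y: "y \<in> span S" "L x = L y" by auto
    have "f (x - y) = 0" if "f \<in> F" for f
    proof -
      have "f x = f y" using fun_cong[OF y(2), of f] that by (simp add: L_def)
      moreover have "f x = f (x - y) + f y" using lin(1)[OF that, of "x - y" y] by simp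
      ultimately show ?thesis by simp
    qed
    then show ?thesis using ker y(1) by blast
  qed
  then show ?thesis using S(1) finite_codim_iff_span[OF H] by blast
qed

lemma finite_codim_UNIV: "finite_codim scale UNIV"
  by (rule finite_codim_if_functionals[of _ "{}"]) auto

text \<open>A vector whose coordinates vanish in both quotients lies in both subspaces, so the two
  finite families of coordinate functionals together serve as \<open>F\<close> in
  \<open>finite_codim_if_functionals\<close>.\<close>

lemma finite_codim_Int:
  assumes H: "subspace H" "finite_codim scale H" and K: "subspace K" "finite_codim scale K"
  shows "finite_codim scale (H \<inter> K)"
proof -
  obtain E \<phi> where E: "finite E" "\<And>e. \<phi> e \<in> linear_dual scale"
    "\<And>x. x - (\<Sum>e\<in>E. scale (\<phi> e x) e) \<in> H"
    using finite_codim_dual_basis[OF H] by metis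
  obtain E' \<phi>' where E': "finite E'" "\<And>e. \<phi>' e \<in> linear_dual scale"
    "\<And>x. x - (\<Sum>e\<in>E'. scale (\<phi>' e x) e) \<in> K"
    using finite_codim_dual_basis[OF K] by metis
  show ?thesis
  proof (rule finite_codim_if_functionals)
    show "subspace (H \<inter> K)" using H K by (simp add: subspace_inter)
    show "finite (\<phi> ` E \<union> \<phi>' ` E')" "\<phi> ` E \<union> \<phi>' ` E' \<subseteq> linear_dual scale"
      using E E' by auto
    fix x assume "\<And>f. f \<in> \<phi> ` E \<union> \<phi>' ` E' \<Longrightarrow> f x = 0"
    then have "\<forall>e\<in>E. \<phi> e x = 0" "\<forall>e\<in>E'. \<phi>' e x = 0" by auto
    then show "x \<in> H \<inter> K" using E(3)[of x] E'(3)[of x] by simp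
  qed
qed

end


section \<open>Pullbacks\<close>

text \<open>Brings comultiplication and coaction under \<open>pullback\<close>, so that
  \<open>tensor_map_pullback\<close> covers every structure map.\<close>

lemma pullback2_eq: "pullback2 B = pullback (\<lambda>(x, y). B x y)"
  by (auto simp: pullback2_def pullback_def fun_eq_iff)

lemma linear_between_pullback:
  assumes "\<And>f. f \<in> C \<Longrightarrow> pullback p f \<in> D"
  shows "linear_between C D (pullback p)"
  using assms by (auto simp: linear_between_def pullback_def fun_scale_def)

text \<open>On pure tensors, composing the factors with \<open>p\<close> and \<open>q\<close> is the
  same as composing the tensor with \<open>map_prod p q\<close>; finite sums preserve this. It
  eliminates the definite description in \<open>tensor_map\<close> and makes pointwise evaluation
  possible.\<close>

lemma tensor_map_pullback:
  assumes "fun_space.subspace C" "fun_space.subspace D"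
    and "linear_between C C' (pullback p)" "linear_between D D' (pullback q)"
    and "t \<in> tensor_space C D"
  shows "tensor_map C D (pullback p) (pullback q) t = pullback (map_prod p q) t"
proof -
  obtain n :: nat and f g where fg: "\<And>i. i < n \<Longrightarrow> f i \<in> C \<and> g i \<in> D"
    and t: "t = (\<Sum>i<n. tensor (f i) (g i))"
    using tensor_space_elem[OF assms(1,5)] by metis
  have "tensor_map C D (pullback p) (pullback q) t =
      (\<Sum>i<n. tensor (pullback p (f i)) (pullback q (g i)))"
    unfolding t by (rule tensor_map_sum[OF assms(1-4) fg])
  then show ?thesis
    by (auto simp: t pullback_def tensor_def fun_eq_iff sum_fun_apply)
qed

text \<open>Serves both the product and the action. The slices are taken at the dual basis vectors
  \<open>e\<close>, which are not known in advance, hence \<open>left\<close> is required for every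
  \<open>v\<close>; \<open>right\<close> covers the coordinate functionals, which kill
  \<open>H\<close>.\<close>

lemma pullback2_in_tensor_space:
  assumes B: "bilinear_map sU sV sW B" and \<xi>: "\<xi> \<in> linear_dual sW"
    and H: "module.subspace sV H" "finite_codim sV H"
    and ker: "\<And>u h. h \<in> H \<Longrightarrow> \<xi> (B u h) = 0"
    and left: "\<And>v. (\<lambda>u. \<xi> (B u v)) \<in> A"
    and right: "\<And>\<phi>. \<phi> \<in> linear_dual sV \<Longrightarrow> (\<And>h. h \<in> H \<Longrightarrow> \<phi> h = 0) \<Longrightarrow> \<phi> \<in> C"
  shows "pullback2 B \<xi> \<in> tensor_space A C"
proof -
  have B_lin: "Vector_Spaces.linear sV sW (B u)" for u using B by (simp add: bilinear_map_def)
  then interpret V: vector_space sV by (simp add: Vector_Spaces.linear_iff)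
  have \<xi>_lin: "Vector_Spaces.linear sW (*) \<xi>" using \<xi> by (simp add: linear_dual_def)
  have comp: "module_hom sV (*) (\<lambda>v. \<xi> (B u v))" for u
    using module_hom_compose[of sV sW "B u" "(*)" \<xi>] B_lin \<xi>_lin
    by (simp add: linear_iff_module_hom o_def)
  obtain E \<phi> where E: "finite E" "\<And>e. \<phi> e \<in> linear_dual sV"
    "\<And>e x. e \<in> E \<Longrightarrow> x \<in> H \<Longrightarrow> \<phi> e x = 0" "\<And>x. x - (\<Sum>e\<in>E. sV (\<phi> e x) e) \<in> H"
    using V.finite_codim_dual_basis[OF H] by metis
  \<comment> \<open>Replacing \<open>v\<close> by its expansion modulo \<open>H\<close> does not
    change the value, because the error term lies in \<open>H\<close> and is killed by
    \<open>ker\<close>.\<close>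
  have expand: "\<xi> (B u v) = (\<Sum>e\<in>E. \<xi> (B u e) * \<phi> e v)" for u v
  proof -
    have "\<xi> (B u (v - (\<Sum>e\<in>E. sV (\<phi> e v) e))) = 0" using E(4) ker by blast
    then show ?thesis
      by (simp add: module_hom.diff[OF comp] module_hom.sum[OF comp] module_hom.scale[OF comp]
          mult.commute)
  qed
  have "pullback2 B \<xi> = (\<Sum>e\<in>E. tensor (\<lambda>u. \<xi> (B u e)) (\<phi> e))"
    by (simp add: pullback2_def tensor_def fun_eq_iff sum_fun_apply expand[symmetric])
  also have "\<dots> \<in> tensor_space A C"
    unfolding tensor_space_def
    using left right E by (intro fun_space.span_sum fun_space.span_base) blast
  finally show ?thesis .
qed

lemma linear_dual_comp:
  assumes "Vector_Spaces.linear s1 s2 p" "\<xi> \<in> linear_dual s2"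
  shows "(\<lambda>x. \<xi> (p x)) \<in> linear_dual s1"
  using module_hom_compose[of s1 s2 p "(*)" \<xi>] assms
  by (simp add: linear_dual_def linear_iff_module_hom o_def)


section \<open>The Sweedler dual of a Hom-algebra\<close>

context hom_algebra
begin

definition cofinite_ideal :: "'g set \<Rightarrow> bool" where
  "cofinite_ideal J \<longleftrightarrow> is_ideal sG mult \<alpha> J \<and> finite_codim sG J"

lemma cofinite_ideal_UNIV: "cofinite_ideal UNIV"
  by (simp add: cofinite_ideal_def is_ideal_def finite_codim_UNIV)

lemma cofinite_ideal_Int:
  "cofinite_ideal I \<Longrightarrow> cofinite_ideal J \<Longrightarrow> cofinite_ideal (I \<inter> J)"
  by (auto simp: cofinite_ideal_def is_ideal_def finite_codim_Int subspace_inter)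

lemma cofinite_idealD:
  assumes "cofinite_ideal J"
  shows "subspace J" "finite_codim sG J" "a \<in> J \<Longrightarrow> \<alpha> a \<in> J"
    "a \<in> J \<Longrightarrow> mult a b \<in> J" "a \<in> J \<Longrightarrow> mult b a \<in> J"
  using assms by (auto simp: cofinite_ideal_def is_ideal_def)

text \<open>Common form of both Sweedler duals: \<open>T a = {a}\<close> yields the dual of the
  algebra, and \<open>T a = range (\<lambda>m. \<psi> m a)\<close> that of the module. Closure under
  addition comes from intersecting the two witnessing ideals.\<close>

lemma subspace_cofinite_annihilators:
  fixes sM :: "'k \<Rightarrow> 'm::ab_group_add \<Rightarrow> 'm" and T :: "'g \<Rightarrow> 'm set"
  assumes "vector_space sM"
  shows "fun_space.subspace
    {f \<in> linear_dual sM. \<exists>J. cofinite_ideal J \<and> (\<forall>a\<in>J. \<forall>x\<in>T a. f x = 0)}"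
    (is "fun_space.subspace ?D")
proof -
  interpret M: vector_space sM by fact
  show ?thesis
  proof (rule fun_space.subspaceI)
    show "0 \<in> ?D" using cofinite_ideal_UNIV by (auto simp: M.linear_dual_iff)
  next
    fix f g assume "f \<in> ?D" "g \<in> ?D"
    then obtain I J where "cofinite_ideal I" "\<forall>a\<in>I. \<forall>x\<in>T a. f x = 0"
      "cofinite_ideal J" "\<forall>a\<in>J. \<forall>x\<in>T a. g x = 0" by blast
    then have "cofinite_ideal (I \<inter> J) \<and> (\<forall>a\<in>I \<inter> J. \<forall>x\<in>T a. (f + g) x = 0)"
      by (auto simp: cofinite_ideal_Int)
    moreover have "f + g \<in> linear_dual sM"
      using \<open>f \<in> ?D\<close> \<open>g \<in> ?D\<close> by (simp add: M.linear_dual_iff algebra_simps)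
    ultimately show "f + g \<in> ?D" by blast
  next
    fix c f assume "f \<in> ?D"
    then show "fun_scale c f \<in> ?D"
      by (auto simp: M.linear_dual_iff fun_scale_def algebra_simps)
  qed
qed

lemma algebra_dual_eq:
  "algebra_dual sG mult \<alpha> =
    {f \<in> linear_dual sG. \<exists>J. cofinite_ideal J \<and> (\<forall>a\<in>J. \<forall>x\<in>{a}. f x = 0)}"
  by (auto simp: algebra_dual_def cofinite_ideal_def subset_iff)

lemma algebra_dualI:
  "f \<in> linear_dual sG \<Longrightarrow> cofinite_ideal J \<Longrightarrow> (\<And>a. a \<in> J \<Longrightarrow> f a = 0) \<Longrightarrow>
    f \<in> algebra_dual sG mult \<alpha>"
  by (auto simp: algebra_dual_eq)

lemma algebra_dualE:
  assumes "f \<in> algebra_dual sG mult \<alpha>"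
  obtains J where "f \<in> linear_dual sG" "cofinite_ideal J" "\<And>a. a \<in> J \<Longrightarrow> f a = 0"
  using assms by (auto simp: algebra_dual_eq intro: that)

lemma subspace_algebra_dual: "fun_space.subspace (algebra_dual sG mult \<alpha>)"
  unfolding algebra_dual_eq by (rule subspace_cofinite_annihilators) (rule vector_space_axioms)

text \<open>The same ideal remains a witness, since it is stable under \<alpha>.\<close>

lemma pullback_twist_algebra_dual:
  assumes "f \<in> algebra_dual sG mult \<alpha>"
  shows "pullback \<alpha> f \<in> algebra_dual sG mult \<alpha>"
  using assms linear_twist
  by (elim algebra_dualE, intro algebra_dualI)
    (auto simp: pullback_def o_def linear_dual_comp cofinite_idealD(3))

text \<open>Both sides of the ideal enter: \<open>f (mult u v)\<close> vanishes for \<open>v\<close>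
  in \<open>J\<close>, which gives finite rank, and for \<open>u\<close> in \<open>J\<close>, which
  puts the left slices into the dual.\<close>

lemma pullback2_mult_algebra_dual:
  assumes "f \<in> algebra_dual sG mult \<alpha>"
  shows "pullback2 mult f \<in> tensor_space (algebra_dual sG mult \<alpha>) (algebra_dual sG mult \<alpha>)"
proof -
  obtain J where J: "f \<in> linear_dual sG" "cofinite_ideal J" "\<And>a. a \<in> J \<Longrightarrow> f a = 0"
    using assms by (rule algebra_dualE) (rule that)
  have "Vector_Spaces.linear sG sG (\<lambda>u. mult u v)" for v
    using bilinear_mult by (simp add: bilinear_map_def)
  from linear_dual_comp[OF this J(1)]
  have "(\<lambda>u. f (mult u v)) \<in> algebra_dual sG mult \<alpha>" for v
    using J by (intro algebra_dualI[of _ J]) (auto simp: cofinite_idealD)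
  then show ?thesis
    using J by (intro pullback2_in_tensor_space[OF bilinear_mult, of _ J])
      (auto simp: cofinite_idealD intro: algebra_dualI)
qed

lemma linear_between_comult:
  "linear_between (algebra_dual sG mult \<alpha>)
    (tensor_space (algebra_dual sG mult \<alpha>) (algebra_dual sG mult \<alpha>)) (pullback (\<lambda>(x, y). mult x y))"
  using pullback2_mult_algebra_dual by (intro linear_between_pullback) (simp add: pullback2_eq)

lemma linear_between_cotwist:
  "linear_between (algebra_dual sG mult \<alpha>) (algebra_dual sG mult \<alpha>) (pullback \<alpha>)"
  by (intro linear_between_pullback pullback_twist_algebra_dual)

lemma hom_coalgebra_dual:
  "hom_coalgebra (algebra_dual sG mult \<alpha>) (pullback2 mult) (pullback \<alpha>)"
proof -
  note tensor = tensor_map_pullback[OF subspace_algebra_dual subspace_algebra_dual]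
  note lin = linear_between_comult linear_between_cotwist
  note mem = pullback2_mult_algebra_dual[unfolded pullback2_eq]
  show ?thesis
    unfolding pullback2_eq
  proof unfold_locales
    fix c assume c: "c \<in> algebra_dual sG mult \<alpha>"
    \<comment> \<open>At \<open>(x, y, z)\<close> the two sides apply \<open>c\<close> to
      \<open>mult (\<alpha> x) (mult y z)\<close> and to
      \<open>mult (mult x y) (\<alpha> z)\<close>.\<close>
    show "tensor_map (algebra_dual sG mult \<alpha>) (algebra_dual sG mult \<alpha>) (pullback \<alpha>)
        (pullback (\<lambda>(x, y). mult x y)) (pullback (\<lambda>(x, y). mult x y) c) =
      tensor_assoc (tensor_map (algebra_dual sG mult \<alpha>) (algebra_dual sG mult \<alpha>)
        (pullback (\<lambda>(x, y). mult x y)) (pullback \<alpha>) (pullback (\<lambda>(x, y). mult x y) c))"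
      by (simp add: tensor[OF lin(2,1) mem[OF c]] tensor[OF lin mem[OF c]])
        (auto simp: pullback_def tensor_assoc_def fun_eq_iff hom_assoc)
    show "pullback (\<lambda>(x, y). mult x y) (pullback \<alpha> c) =
      tensor_map (algebra_dual sG mult \<alpha>) (algebra_dual sG mult \<alpha>) (pullback \<alpha>) (pullback \<alpha>)
        (pullback (\<lambda>(x, y). mult x y) c)"
      by (simp add: tensor[OF lin(2,2) mem[OF c]])
        (auto simp: pullback_def fun_eq_iff twist_mult)
  qed (simp_all add: subspace_algebra_dual lin)
qed

end


section \<open>The Sweedler dual of a right Hom-module\<close>

context right_hom_module
begin

text \<open>A linear form vanishes on a span as soon as it vanishes on the generators; this gives
  the shape used in \<open>subspace_cofinite_annihilators\<close>.\<close>

lemma module_dual_eq: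
  "module_dual sG mult \<alpha> sM \<psi> =
    {\<xi> \<in> linear_dual sM. \<exists>I. cofinite_ideal I \<and> (\<forall>a\<in>I. \<forall>x\<in>range (\<lambda>m. \<psi> m a). \<xi> x = 0)}"
proof -
  have "(\<forall>x\<in>act_span sM \<psi> I. \<xi> x = 0) \<longleftrightarrow> (\<forall>a\<in>I. \<forall>x\<in>range (\<lambda>m. \<psi> m a). \<xi> x = 0)"
    if "\<xi> \<in> linear_dual sM" for \<xi> I
  proof
    assume "\<forall>x\<in>act_span sM \<psi> I. \<xi> x = 0"
    then show "\<forall>a\<in>I. \<forall>x\<in>range (\<lambda>m. \<psi> m a). \<xi> x = 0"
      by (auto simp: act_span_def intro!: M.span_base)
  next
    have "module_hom sM (*) \<xi>" using that by (simp add: linear_dual_def linear_iff_module_hom)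
    moreover assume "\<forall>a\<in>I. \<forall>x\<in>range (\<lambda>m. \<psi> m a). \<xi> x = 0"
    ultimately show "\<forall>x\<in>act_span sM \<psi> I. \<xi> x = 0"
      unfolding act_span_def by (intro ballI) (rule module_hom.eq_0_on_span, auto)
  qed
  then show ?thesis by (auto simp: module_dual_def cofinite_ideal_def)
qed

lemma module_dualI:
  "\<xi> \<in> linear_dual sM \<Longrightarrow> cofinite_ideal I \<Longrightarrow> (\<And>m a. a \<in> I \<Longrightarrow> \<xi> (\<psi> m a) = 0) \<Longrightarrow>
    \<xi> \<in> module_dual sG mult \<alpha> sM \<psi>"
  by (auto simp: module_dual_eq)

lemma module_dualE:
  assumes "\<xi> \<in> module_dual sG mult \<alpha> sM \<psi>"
  obtains I where "\<xi> \<in> linear_dual sM" "cofinite_ideal I" "\<And>m a. a \<in> I \<Longrightarrow> \<xi> (\<psi> m a) = 0"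
  using assms by (auto simp: module_dual_eq intro: that)

lemma subspace_module_dual: "fun_space.subspace (module_dual sG mult \<alpha> sM \<psi>)"
  unfolding module_dual_eq by (rule subspace_cofinite_annihilators) (rule M.vector_space_axioms)

text \<open>By \<open>twist_act\<close>, applying \<gamma> to \<open>\<psi> m a\<close> gives
  \<open>\<psi> (\<gamma> m) (\<alpha> a)\<close>, and \<open>\<alpha> a\<close> stays in the
  ideal.\<close>

lemma pullback_twist_module_dual:
  assumes "\<xi> \<in> module_dual sG mult \<alpha> sM \<psi>"
  shows "pullback \<gamma> \<xi> \<in> module_dual sG mult \<alpha> sM \<psi>"
  using assms linear_mod_twist
  by (elim module_dualE, intro module_dualI)
    (auto simp: pullback_def o_def linear_dual_comp cofinite_idealD(3) twist_act[symmetric])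

lemma pullback2_act_module_dual:
  assumes "surj \<alpha>" and "\<xi> \<in> module_dual sG mult \<alpha> sM \<psi>"
  shows "pullback2 \<psi> \<xi> \<in> tensor_space (module_dual sG mult \<alpha> sM \<psi>) (algebra_dual sG mult \<alpha>)"
proof -
  obtain I where I: "\<xi> \<in> linear_dual sM" "cofinite_ideal I" "\<And>m a. a \<in> I \<Longrightarrow> \<xi> (\<psi> m a) = 0"
    using assms(2) by (rule module_dualE) (rule that)
  have "(\<lambda>m. \<xi> (\<psi> m g)) \<in> module_dual sG mult \<alpha> sM \<psi>" for g
  proof -
    \<comment> \<open>With \<open>g = \<alpha> h\<close>, the value at \<open>\<psi> m a\<close>
      becomes \<open>\<xi> (\<psi> (\<gamma> m) (mult a h))\<close>. For \<open>a\<close> in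
      \<open>I\<close> the product \<open>mult a h\<close> is again in \<open>I\<close>, so the same
      ideal witnesses membership.\<close>
    obtain h where h: "g = \<alpha> h" using \<open>surj \<alpha>\<close> by auto
    have "Vector_Spaces.linear sM sM (\<lambda>m. \<psi> m g)"
      using bilinear_act by (simp add: bilinear_map_def)
    from linear_dual_comp[OF this I(1)] show ?thesis
      using I by (intro module_dualI[of _ I]) (auto simp: h act_assoc cofinite_idealD)
  qed
  then show ?thesis
    using I by (intro pullback2_in_tensor_space[OF bilinear_act, of _ I])
      (auto simp: cofinite_idealD intro: algebra_dualI)
qed

lemma right_hom_comodule_dual:
  assumes "surj \<alpha>"
  shows "right_hom_comodule (algebra_dual sG mult \<alpha>) (pullback2 mult) (pullback \<alpha>)
    (module_dual sG mult \<alpha> sM \<psi>) (pullback2 \<psi>) (pullback \<gamma>)"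
proof -
  note tensor = tensor_map_pullback[OF subspace_module_dual subspace_algebra_dual]
  note mem = pullback2_act_module_dual[OF assms, unfolded pullback2_eq]
  have coact: "linear_between (module_dual sG mult \<alpha> sM \<psi>)
      (tensor_space (module_dual sG mult \<alpha> sM \<psi>) (algebra_dual sG mult \<alpha>))
      (pullback (\<lambda>(x, y). \<psi> x y))"
    by (intro linear_between_pullback mem)
  have cotwist:
    "linear_between (module_dual sG mult \<alpha> sM \<psi>) (module_dual sG mult \<alpha> sM \<psi>) (pullback \<gamma>)"
    by (intro linear_between_pullback pullback_twist_module_dual)
  show ?thesis
    unfolding pullback2_eq
  proof (intro right_hom_comodule.intro right_hom_comodule_axioms.intro
      hom_coalgebra_dual[unfolded pullback2_eq])
    fix \<xi> assume \<xi>: "\<xi> \<in> module_dual sG mult \<alpha> sM \<psi>"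
    \<comment> \<open>At \<open>(m, g, h)\<close> the two sides apply \<open>\<xi>\<close> to
      \<open>\<psi> (\<psi> m g) (\<alpha> h)\<close> and to
      \<open>\<psi> (\<gamma> m) (mult g h)\<close>.\<close>
    show "tensor_assoc (tensor_map (module_dual sG mult \<alpha> sM \<psi>) (algebra_dual sG mult \<alpha>)
        (pullback (\<lambda>(x, y). \<psi> x y)) (pullback \<alpha>) (pullback (\<lambda>(x, y). \<psi> x y) \<xi>)) =
      tensor_map (module_dual sG mult \<alpha> sM \<psi>) (algebra_dual sG mult \<alpha>) (pullback \<gamma>)
        (pullback (\<lambda>(x, y). mult x y)) (pullback (\<lambda>(x, y). \<psi> x y) \<xi>)"
      by (simp add: tensor[OF coact linear_between_cotwist mem[OF \<xi>]]
            tensor[OF cotwist linear_between_comult mem[OF \<xi>]])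
        (auto simp: pullback_def tensor_assoc_def fun_eq_iff act_assoc)
    show "tensor_map (module_dual sG mult \<alpha> sM \<psi>) (algebra_dual sG mult \<alpha>) (pullback \<gamma>) (pullback \<alpha>)
        (pullback (\<lambda>(x, y). \<psi> x y) \<xi>) = pullback (\<lambda>(x, y). \<psi> x y) (pullback \<gamma> \<xi>)"
      by (simp add: tensor[OF cotwist linear_between_cotwist mem[OF \<xi>]])
        (auto simp: pullback_def fun_eq_iff twist_act)
  qed (simp_all add: subspace_module_dual coact cotwist)
qed

end

section \<open>Transposes of Hom-module morphisms\<close>

text \<open>An ideal witnessing \<open>\<xi>\<close> also witnesses its pullback: \<sigma> turns
  \<open>\<psi> m a\<close> into \<open>\<psi>' (\<sigma> m) (\<alpha> a)\<close>, and ideals are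
  stable under \<alpha>.\<close>

lemma (in right_hom_module_morphism) pullback_morphism_module_dual:
  assumes "\<xi> \<in> module_dual sG mult \<alpha> sN \<psi>'"
  shows "pullback \<sigma> \<xi> \<in> module_dual sG mult \<alpha> sM \<psi>"
  using assms linear_morphism
  by (elim N.module_dualE, intro M.module_dualI)
    (auto simp: pullback_def o_def linear_dual_comp M.cofinite_idealD(3) morphism_act)

theorem theorem5:
  fixes sG :: "'k::field_char_0 \<Rightarrow> 'g::ab_group_add \<Rightarrow> 'g"
    and mult :: "'g \<Rightarrow> 'g \<Rightarrow> 'g" and \<alpha> :: "'g \<Rightarrow> 'g"
    and sM :: "'k \<Rightarrow> 'm::ab_group_add \<Rightarrow> 'm" and \<psi> :: "'m \<Rightarrow> 'g \<Rightarrow> 'm" and \<gamma> :: "'m \<Rightarrow> 'm"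
    and sN :: "'k \<Rightarrow> 'n::ab_group_add \<Rightarrow> 'n" and \<psi>' :: "'n \<Rightarrow> 'g \<Rightarrow> 'n" and \<gamma>' :: "'n \<Rightarrow> 'n"
    and \<sigma> :: "'m \<Rightarrow> 'n"
  assumes "hom_algebra sG mult \<alpha>" and "bij \<alpha>"
    and "right_hom_module sG mult \<alpha> sM \<psi> \<gamma>"
    and "right_hom_module sG mult \<alpha> sN \<psi>' \<gamma>'"
    and "right_hom_module_morphism sG mult \<alpha> sM \<psi> \<gamma> sN \<psi>' \<gamma>' \<sigma>"
  shows "right_hom_comodule_morphism
    (algebra_dual sG mult \<alpha>) (pullback2 mult) (pullback \<alpha>)
    (module_dual sG mult \<alpha> sN \<psi>') (pullback2 \<psi>') (pullback \<gamma>')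
    (module_dual sG mult \<alpha> sM \<psi>) (pullback2 \<psi>) (pullback \<gamma>)
    (pullback \<sigma>)"
proof -
  interpret right_hom_module_morphism sG mult \<alpha> sM \<psi> \<gamma> sN \<psi>' \<gamma>' \<sigma> by fact
  have "surj \<alpha>" using \<open>bij \<alpha>\<close> by (rule bij_is_surj)
  have lin: "linear_between (module_dual sG mult \<alpha> sN \<psi>') (module_dual sG mult \<alpha> sM \<psi>) (pullback \<sigma>)"
    by (intro linear_between_pullback pullback_morphism_module_dual)
  show ?thesis
  proof (intro right_hom_comodule_morphism.intro right_hom_comodule_morphism_axioms.intro
      M.right_hom_comodule_dual N.right_hom_comodule_dual \<open>surj \<alpha>\<close> lin)
    fix \<xi> assume \<xi>: "\<xi> \<in> module_dual sG mult \<alpha> sN \<psi>'"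
    \<comment> \<open>At \<open>(m, g)\<close> this is \<open>\<xi>\<close> applied to
      \<open>morphism_act\<close>; the \<alpha> in that condition is exactly what the cotwist
      contributes in the second tensor factor.\<close>
    show "pullback2 \<psi> (pullback \<sigma> \<xi>) = tensor_map (module_dual sG mult \<alpha> sN \<psi>')
        (algebra_dual sG mult \<alpha>) (pullback \<sigma>) (pullback \<alpha>) (pullback2 \<psi>' \<xi>)"
      by (simp add: tensor_map_pullback[OF N.subspace_module_dual M.subspace_algebra_dual lin
            M.linear_between_cotwist N.pullback2_act_module_dual[OF \<open>surj \<alpha>\<close> \<xi>]])
        (auto simp: pullback_def pullback2_def fun_eq_iff morphism_act)
    show "pullback \<gamma> (pullback \<sigma> \<xi>) = pullback \<sigma> (pullback \<gamma>' \<xi>)"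
      by (auto simp: pullback_def fun_eq_iff morphism_twist)
  qed
qed

end
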